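(* There exist constants $0<c\le C$ and $D>0$ such that for all positive integers $m,n$ with $\max\{m,n\}\ge 2$, the complete bipartite graph $K_{m,n}$ admits a $2$-layered grid drawing whose total resolution $\rho$ satisfies $\frac{c}{\max\{m,n\}}\le\rho\le\frac{C}{\max\{m,n\}}$ and whose area is at most $D\cdot\max\{m^2,n^2\}$; that is, a $2$-layered grid drawing of total resolution $\Theta(\frac{1}{\max\{m,n\}})$ and area $O(\max\{m^2,n^2\})$.
   Context: $K_{m,n}$ has vertex bipartition $V_1\cup V_2$ with $|V_1|=m$, $|V_2|=n$ and all edges between $V_1$ and $V_2$. A $2$-layered drawing is a straight-line drawing (nodes at distinct points, edges as line segments between their endpoints) in which all nodes of $V_1$ lie on one line and all nodes of $V_2$ lie on a second, distinct, parallel line. It is a grid drawing if every node has integer coordinates; its area is the area of the smallest axis-parallel rectangle containing it. The angular resolution of a drawing is the smallest angle formed by two edges incident to a common node. The crossing resolution is the smallest angle formed at a crossing of two edges (the smaller of the two supplementary angles at the crossing); if there are no crossings it is $+\infty$. The total resolution is the minimum of the angular and crossing resolution. *)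

theory Defs
  imports "HOL-Analysis.Analysis"
begin

text \<open>
  A simple graph is given by a vertex set \<open>V\<close> and a set \<open>E\<close> of two-element subsets of \<open>V\<close>.
  A straight-line drawing is determined by the placement \<open>p\<close> of its nodes in the plane.
\<close>

type_synonym point = "real \<times> real"

definition Kbip_left :: "nat \<Rightarrow> (nat + nat) set" where
  "Kbip_left m = Inl ` {..<m}"

definition Kbip_right :: "nat \<Rightarrow> (nat + nat) set" where
  "Kbip_right n = Inr ` {..<n}"

definition Kbip_verts :: "nat \<Rightarrow> nat \<Rightarrow> (nat + nat) set" where
  "Kbip_verts m n = Kbip_left m \<union> Kbip_right n"

definition Kbip_edges :: "nat \<Rightarrow> nat \<Rightarrow> (nat + nat) set set" where
  "Kbip_edges m n = {{u, v} | u v. u \<in> Kbip_left m \<and> v \<in> Kbip_right n}"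

definition straight_line_drawing :: "'v set \<Rightarrow> ('v \<Rightarrow> point) \<Rightarrow> bool" where
  "straight_line_drawing V p \<longleftrightarrow> inj_on p V"

text \<open>The convex hull of the two end points of an edge is its segment.\<close>

definition drawing_points :: "'v set \<Rightarrow> 'v set set \<Rightarrow> ('v \<Rightarrow> point) \<Rightarrow> point set" where
  "drawing_points V E p = p ` V \<union> (\<Union>e\<in>E. convex hull (p ` e))"

definition line :: "point set \<Rightarrow> bool" where
  "line L \<longleftrightarrow> affine L \<and> aff_dim L = 1"

definition two_layered :: "'v set \<Rightarrow> 'v set \<Rightarrow> ('v \<Rightarrow> point) \<Rightarrow> bool" where
  "two_layered V1 V2 p \<longleftrightarrow>
     (\<exists>L1 L2. line L1 \<and> line L2 \<and> affine_parallel L1 L2 \<and> L1 \<noteq> L2 \<and> p ` V1 \<subseteq> L1 \<and> p ` V2 \<subseteq> L2)"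

definition grid_drawing :: "'v set \<Rightarrow> ('v \<Rightarrow> point) \<Rightarrow> bool" where
  "grid_drawing V p \<longleftrightarrow> (\<forall>v\<in>V. fst (p v) \<in> \<int> \<and> snd (p v) \<in> \<int>)"

text \<open>For finite nonempty \<open>V\<close> the infimum is attained by the bounding box of the node positions.\<close>

definition drawing_area :: "'v set \<Rightarrow> 'v set set \<Rightarrow> ('v \<Rightarrow> point) \<Rightarrow> real" where
  "drawing_area V E p = Inf {measure lborel (cbox a b) | a b. drawing_points V E p \<subseteq> cbox a b}"

text \<open>The angle in \<open>[0, pi]\<close> between two vectors; it is only used for nonzero vectors.\<close>

definition vec_angle :: "point \<Rightarrow> point \<Rightarrow> real" where
  "vec_angle x y = arccos ((x \<bullet> y) / (norm x * norm y))"

text \<open>Resolutions are extended reals: the infimum over the empty set is \<open>\<infinity>\<close>.\<close>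

definition angular_resolution :: "'v set \<Rightarrow> 'v set set \<Rightarrow> ('v \<Rightarrow> point) \<Rightarrow> ereal" where
  "angular_resolution V E p =
     Inf {ereal (vec_angle (p u - p v) (p w - p v)) | u v w.
            v \<in> V \<and> {v, u} \<in> E \<and> {v, w} \<in> E \<and> u \<noteq> w}"

text \<open>
  Edges cross where they share a point interior to both. Depending on the orientation chosen for
  the two edges, \<open>vec_angle\<close> yields one or the other of the two supplementary angles.
\<close>

definition crossing_resolution :: "'v set set \<Rightarrow> ('v \<Rightarrow> point) \<Rightarrow> ereal" where
  "crossing_resolution E p =
     Inf {ereal (min (vec_angle (p v - p u) (p z - p w)) (pi - vec_angle (p v - p u) (p z - p w)))
          | u v w z. {u, v} \<in> E \<and> {w, z} \<in> E \<and> {u, v} \<noteq> {w, z} \<and>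
            open_segment (p u) (p v) \<inter> open_segment (p w) (p z) \<noteq> {}}"

definition total_resolution :: "'v set \<Rightarrow> 'v set set \<Rightarrow> ('v \<Rightarrow> point) \<Rightarrow> ereal" where
  "total_resolution V E p = min (angular_resolution V E p) (crossing_resolution E p)"

end

theory Submission
  imports Defs
begin

text \<open>
  With \<open>N = max m n\<close>, place the two layers at the points \<open>(i, 0)\<close> and \<open>(j, N)\<close>. Every edge has a
  direction \<open>(a, N)\<close> with an integer \<open>\<bar>a\<bar> \<le> N\<close>, and edges that meet have distinct values of \<open>a\<close>.
  The sine of the angle of \<open>(a, N)\<close> and \<open>(b, N)\<close> is \<open>\<bar>a - b\<bar> N\<close> divided by the product of the
  norms, hence at least \<open>1 / (2 N)\<close>; it bounds both the angle and its supplement from below.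
  Conversely, the directions \<open>(0, N)\<close> and \<open>(1, N)\<close> at a common node form the angle
  \<open>arctan (1 / N) \<le> 1 / N\<close>.
\<close>

section \<open>Sines and angles of plane vectors\<close>

text \<open>Lagrange's identity: the squared determinant equals \<open>(norm x)\<^sup>2 * (norm
  y)\<^sup>2 - (x \<bullet> y)\<^sup>2\<close>, which is what
  \<open>sin (arccos r) = sqrt (1 - r\<^sup>2)\<close> leaves under the root.\<close>

lemma sin_vec_angle:
  assumes "x \<noteq> 0" "y \<noteq> 0"
  shows "sin (vec_angle x y) = \<bar>fst x * snd y - snd x * fst y\<bar> / (norm x * norm y)"
proof -
  define r where "r = (x \<bullet> y) / (norm x * norm y)"
  have pos: "norm x * norm y > 0" using assms by simp
  have "\<bar>r\<bar> \<le> 1"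
    using Cauchy_Schwarz_ineq2[of x y] pos unfolding r_def by (simp add: divide_simps)
  then have "sin (vec_angle x y) = sqrt (1 - r\<^sup>2)"
    unfolding vec_angle_def r_def[symmetric] by (simp add: sin_arccos_abs)
  also have "1 - r\<^sup>2 = ((norm x)\<^sup>2 * (norm y)\<^sup>2 - (x \<bullet> y)\<^sup>2) / (norm x * norm y)\<^sup>2"
    using assms unfolding r_def by (simp add: power_divide power_mult_distrib field_simps)
  also have "(norm x)\<^sup>2 * (norm y)\<^sup>2 - (x \<bullet> y)\<^sup>2 = (fst x * snd y - snd x * fst y)\<^sup>2"
    unfolding power2_norm_eq_inner inner_prod_def
    by (simp add: power2_eq_square algebra_simps)
  finally show ?thesis using pos by (simp add: real_sqrt_divide)
qed

text \<open>An angle in \<open>[0, pi]\<close> and its supplement have the same sine, and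
  \<open>sin t \<le> t\<close> applies to both.\<close>

lemma sin_vec_angle_le_min:
  assumes "x \<noteq> 0" "y \<noteq> 0"
  shows "sin (vec_angle x y) \<le> min (vec_angle x y) (pi - vec_angle x y)"
proof -
  define r where "r = (x \<bullet> y) / (norm x * norm y)"
  have "norm x * norm y > 0" using assms by simp
  then have "\<bar>r\<bar> \<le> 1"
    using Cauchy_Schwarz_ineq2[of x y] unfolding r_def by (simp add: divide_simps)
  then have "0 \<le> vec_angle x y" "vec_angle x y \<le> pi"
    unfolding vec_angle_def r_def[symmetric] by (auto intro: arccos_lbound arccos_ubound)
  then show ?thesis
    using sin_x_le_x[of "vec_angle x y"] sin_x_le_x[of "pi - vec_angle x y"] by simp
qed

text \<open>The determinant is \<open>(a - b) * K\<close> up to sign, so at least \<open>K\<close>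
  in absolute value, while each norm is at most \<open>sqrt 2 * K\<close>. The signs leave the
  orientation of either edge free, and the minimum serves angles at nodes as well as at
  crossings.\<close>

lemma vec_angle_same_height_ge:
  fixes a b K :: real
  assumes K: "K > 0" and ab: "\<bar>a\<bar> \<le> K" "\<bar>b\<bar> \<le> K" "\<bar>a - b\<bar> \<ge> 1"
    and x: "x = (a, K) \<or> x = - (a, K)" and y: "y = (b, K) \<or> y = - (b, K)"
  shows "1 / (2 * K) \<le> min (vec_angle x y) (pi - vec_angle x y)"
proof -
  have ne: "x \<noteq> 0" "y \<noteq> 0" using K x y by (auto simp: zero_prod_def)
  have "norm x = sqrt (a\<^sup>2 + K\<^sup>2)" "norm y = sqrt (b\<^sup>2 + K\<^sup>2)"
    using x y by (auto simp: norm_Pair simp del: uminus_Pair)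
  moreover have "a\<^sup>2 \<le> K\<^sup>2" "b\<^sup>2 \<le> K\<^sup>2"
    using ab K by (simp_all add: abs_le_square_iff[symmetric])
  ultimately have "norm x \<le> sqrt (2 * K\<^sup>2)" "norm y \<le> sqrt (2 * K\<^sup>2)" by simp_all
  then have "norm x * norm y \<le> sqrt (2 * K\<^sup>2) * sqrt (2 * K\<^sup>2)"
    by (intro mult_mono) auto
  then have le: "norm x * norm y \<le> 2 * K\<^sup>2" by simp
  have pos: "norm x * norm y > 0" using ne by simp
  have "\<bar>fst x * snd y - snd x * fst y\<bar> = \<bar>(a - b) * K\<bar>"
    using x y by (auto simp: algebra_simps abs_minus_commute)
  then have cross: "K \<le> \<bar>fst x * snd y - snd x * fst y\<bar>"
    using ab(3) K by (simp add: abs_mult)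
  have "1 / (2 * K) = K / (2 * K\<^sup>2)" using K by (simp add: power2_eq_square)
  also have "\<dots> \<le> \<bar>fst x * snd y - snd x * fst y\<bar> / (norm x * norm y)"
    using cross le pos K by (intro frac_le) auto
  also have "\<dots> = sin (vec_angle x y)" using sin_vec_angle[OF ne] by simp
  also have "\<dots> \<le> min (vec_angle x y) (pi - vec_angle x y)"
    by (rule sin_vec_angle_le_min[OF ne])
  finally show ?thesis .
qed

lemma vec_angle_vertical_neighbour:
  fixes s :: real
  assumes "s \<noteq> 0"
  shows "vec_angle (0, s) (1, s) = arctan (1 / \<bar>s\<bar>)"
proof -
  \<comment> \<open>Pulling out \<open>\<bar>s\<bar>\<close> brings the cosine into the form
    \<open>1 / sqrt (1 + t\<^sup>2)\<close> of \<open>cos (arctan t)\<close>.\<close>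
  have "norm (1::real, s) = \<bar>s\<bar> * sqrt (1 + (1 / \<bar>s\<bar>)\<^sup>2)"
  proof -
    have "1 + s\<^sup>2 = s\<^sup>2 * (1 + (1 / \<bar>s\<bar>)\<^sup>2)"
      using assms by (simp add: power_divide distrib_left)
    then show ?thesis by (simp add: norm_Pair real_sqrt_mult)
  qed
  moreover have "(0, s) \<bullet> (1::real, s) = \<bar>s\<bar> * \<bar>s\<bar>" "norm (0::real, s) = \<bar>s\<bar>"
    by (simp_all add: norm_Pair)
  ultimately have "((0, s) \<bullet> (1::real, s)) / (norm (0::real, s) * norm (1::real, s)) = cos (arctan (1 / \<bar>s\<bar>))"
    using assms by (simp only: cos_arctan) (simp del: abs_mult_self_eq)
  moreover have "0 \<le> arctan (1 / \<bar>s\<bar>)" by (simp add: zero_le_arctan_iff)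
  moreover have "arctan (1 / \<bar>s\<bar>) \<le> pi"
    using arctan_ubound[of "1 / \<bar>s\<bar>"] pi_gt_zero by linarith
  ultimately show ?thesis unfolding vec_angle_def by (simp only: arccos_cos)
qed

section \<open>Horizontal lines as layers\<close>

text \<open>As the hull of two distinct points, the layer is affine and has dimension 1.\<close>

lemma affine_hull_horizontal:
  "affine hull {(0, c), (1, c)} = {q :: point. snd q = c}"
proof (intro set_eqI iffI)
  fix q :: point assume "q \<in> {q. snd q = c}"
  then have "q = (1 - fst q) *\<^sub>R (0, c) + fst q *\<^sub>R (1, c)"
    by (cases q) (simp add: algebra_simps)
  then show "q \<in> affine hull {(0, c), (1, c)}"
    using diff_add_cancel[of 1 "fst q"] unfolding affine_hull_2 by blast
qed (auto simp: affine_hull_2 distrib_right[symmetric])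

lemma line_horizontal: "line {q. snd q = c}"
  unfolding line_def affine_hull_horizontal[symmetric]
  by (simp add: aff_dim_2)

lemma affine_parallel_horizontal:
  "affine_parallel {q :: point. snd q = c} {q. snd q = d}"
  unfolding affine_parallel_def
proof (intro exI[of _ "(0, d - c)"] set_eqI iffI)
  fix q :: point assume "q \<in> {q. snd q = d}"
  then have "q = (0, d - c) + (fst q, c)" by (cases q) auto
  then show "q \<in> (+) (0, d - c) ` {q. snd q = c}"
    by (rule image_eqI) simp
qed auto

section \<open>The layout and its crossings\<close>

lemma Kbip_edges_iff:
  "{u, v} \<in> Kbip_edges m n \<longleftrightarrow>
     (\<exists>i<m. \<exists>j<n. (u = Inl i \<and> v = Inr j) \<or> (u = Inr j \<and> v = Inl i))"
  unfolding Kbip_edges_def Kbip_left_def Kbip_right_def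
  by (auto simp: doubleton_eq_iff)

definition grid_layout :: "real \<Rightarrow> nat + nat \<Rightarrow> point" where
  "grid_layout K v = (case v of Inl i \<Rightarrow> (real i, 0) | Inr j \<Rightarrow> (real j, K))"

lemma grid_layout_simps [simp]:
  "grid_layout K (Inl i) = (real i, 0)"
  "grid_layout K (Inr j) = (real j, K)"
  by (simp_all add: grid_layout_def)

text \<open>The height of the common point fixes the same parameter on both edges. With equal shifts
  the edges are horizontal translates of each other by \<open>k - i\<close>, so meeting at that
  height forces \<open>i = k\<close>. This covers overlapping segments too.\<close>

lemma grid_layout_crossing:
  assumes K: "K > 0"
    and q1: "q \<in> open_segment (grid_layout K (Inl i)) (grid_layout K (Inr j))"
    and q2: "q \<in> open_segment (grid_layout K (Inl k)) (grid_layout K (Inr l))"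
    and par: "real j - real i = real l - real k"
  shows "i = k \<and> j = l"
proof -
  obtain s where s: "q = (1 - s) *\<^sub>R (real i, 0) + s *\<^sub>R (real j, K)"
    using q1 by (auto simp: in_segment)
  obtain t where t: "q = (1 - t) *\<^sub>R (real k, 0) + t *\<^sub>R (real l, K)"
    using q2 by (auto simp: in_segment)
  have "s = t" using s t K by simp
  then have "(1 - s) * real i + s * real j = (1 - s) * real k + s * real l"
    using s t by simp
  then have "real i + s * (real j - real i) = real k + s * (real l - real k)"
    by (simp add: algebra_simps)
  then have "real i = real k" unfolding par by simp
  with par show ?thesis by simp
qed

section \<open>Bounds on the resolutions\<close>

lemma angular_resolution_grid_layout_ge:
  assumes K: "K > 0" "real m \<le> K" "real n \<le> K"
  shows "ereal (1 / (2 * K)) \<le> angular_resolution (Kbip_verts m n) (Kbip_edges m n) (grid_layout K)"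
  unfolding angular_resolution_def
proof (rule Inf_greatest, clarify)
  fix u v w
  let ?p = "grid_layout K"
  assume vu: "{v, u} \<in> Kbip_edges m n" and vw: "{v, w} \<in> Kbip_edges m n" and ne: "u \<noteq> w"
  obtain a b where "?p u - ?p v = (a, K) \<or> ?p u - ?p v = - (a, K)"
    "?p w - ?p v = (b, K) \<or> ?p w - ?p v = - (b, K)" "\<bar>a\<bar> \<le> K" "\<bar>b\<bar> \<le> K" "\<bar>a - b\<bar> \<ge> 1"
  proof (cases v)
    case (Inl i)
    then obtain j l where "i < m" "j < n" "l < n" "u = Inr j" "w = Inr l"
      using vu vw by (auto simp: Kbip_edges_iff)
    then show ?thesis
      using that[of "real j - real i" "real l - real i"] K ne Inl by auto
  next
    case (Inr j)
    then obtain i k where "j < n" "i < m" "k < m" "u = Inl i" "w = Inl k"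
      using vu vw by (auto simp: Kbip_edges_iff)
    \<comment> \<open>Edges leave an upper node downwards, so the vectors are the negatives of
      \<open>(j - i, K)\<close> and \<open>(j - k, K)\<close>.\<close>
    then show ?thesis
      using that[of "real j - real i" "real j - real k"] K ne Inr by auto
  qed
  from vec_angle_same_height_ge[OF K(1) this(3,4,5,1,2)]
  show "ereal (1 / (2 * K)) \<le> ereal (vec_angle (?p u - ?p v) (?p w - ?p v))" by simp
qed

lemma crossing_resolution_grid_layout_ge:
  assumes K: "K > 0" "real m \<le> K" "real n \<le> K"
  shows "ereal (1 / (2 * K)) \<le> crossing_resolution (Kbip_edges m n) (grid_layout K)"
  unfolding crossing_resolution_def
proof (rule Inf_greatest, clarify)
  fix u v w z
  let ?p = "grid_layout K"
  assume uv: "{u, v} \<in> Kbip_edges m n" and wz: "{w, z} \<in> Kbip_edges m n"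
    and ne: "{u, v} \<noteq> {w, z}"
    and int: "open_segment (?p u) (?p v) \<inter> open_segment (?p w) (?p z) \<noteq> {}"
  obtain i j where ij: "i < m" "j < n" "(u = Inl i \<and> v = Inr j) \<or> (u = Inr j \<and> v = Inl i)"
    using uv by (auto simp: Kbip_edges_iff)
  obtain k l where kl: "k < m" "l < n" "(w = Inl k \<and> z = Inr l) \<or> (w = Inr l \<and> z = Inl k)"
    using wz by (auto simp: Kbip_edges_iff)
  obtain q where "q \<in> open_segment (?p u) (?p v)" "q \<in> open_segment (?p w) (?p z)"
    using int by blast
  \<comment> \<open>Both edges are reoriented from the lower to the upper layer; open segments are
    symmetric in their end points.\<close>
  then have q: "q \<in> open_segment (?p (Inl i)) (?p (Inr j))"
    "q \<in> open_segment (?p (Inl k)) (?p (Inr l))"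
    using ij(3) kl(3) by (metis open_segment_commute)+
  define a where "a = real j - real i"
  define b where "b = real l - real k"
  have "\<not> (i = k \<and> j = l)" using ne ij(3) kl(3) by auto
  \<comment> \<open>Equal shifts would make the crossing edges coincide; as the shifts are integers,
    they then differ by at least 1.\<close>
  then have "a \<noteq> b" using grid_layout_crossing[OF K(1) q] unfolding a_def b_def by blast
  moreover have "a - b \<in> \<int>" unfolding a_def b_def by auto
  ultimately have "\<bar>a - b\<bar> \<ge> 1" by (intro Ints_nonzero_abs_ge1) auto
  moreover have "?p v - ?p u = (a, K) \<or> ?p v - ?p u = - (a, K)"
    "?p z - ?p w = (b, K) \<or> ?p z - ?p w = - (b, K)"
    using ij(3) kl(3) unfolding a_def b_def by auto
  moreover have "\<bar>a\<bar> \<le> K" "\<bar>b\<bar> \<le> K"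
    using ij kl K unfolding a_def b_def by auto
  ultimately show "ereal (1 / (2 * K)) \<le> ereal (min (vec_angle (?p v - ?p u) (?p z - ?p w))
      (pi - vec_angle (?p v - ?p u) (?p z - ?p w)))"
    using vec_angle_same_height_ge[OF K(1)] by simp
qed

lemma angular_resolution_grid_layout_le:
  assumes K: "K > 0" and mn: "0 < m" "0 < n" "2 \<le> max m n"
  shows "angular_resolution (Kbip_verts m n) (Kbip_edges m n) (grid_layout K) \<le> ereal (1 / K)"
proof -
  let ?p = "grid_layout K"
  obtain u v w s where uvw: "v \<in> Kbip_verts m n" "{v, u} \<in> Kbip_edges m n"
    "{v, w} \<in> Kbip_edges m n" "u \<noteq> w"
    and s: "?p u - ?p v = (0, s)" "?p w - ?p v = (1, s)" "\<bar>s\<bar> = K"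
  \<comment> \<open>The layer with at least two nodes supplies the neighbours 0 and 1; the common
    node is number 0 of the other layer. The sign of \<open>s\<close> tells on which layer it
    lies.\<close>
  proof (cases "2 \<le> n")
    case True
    then show ?thesis
      using that[of "Inl 0" "Inr 0" "Inr 1" K] mn K
      by (simp add: Kbip_verts_def Kbip_left_def Kbip_edges_iff)
  next
    case False
    then show ?thesis
      using that[of "Inr 0" "Inl 0" "Inl 1" "- K"] mn K
      by (simp add: Kbip_verts_def Kbip_right_def Kbip_edges_iff)
  qed
  have "angular_resolution (Kbip_verts m n) (Kbip_edges m n) ?p
      \<le> ereal (vec_angle (?p u - ?p v) (?p w - ?p v))"
    unfolding angular_resolution_def using uvw by (intro Inf_lower) blast
  also have "vec_angle (?p u - ?p v) (?p w - ?p v) = arctan (1 / K)"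
    using vec_angle_vertical_neighbour[of s] s K by auto
  also have "ereal (arctan (1 / K)) \<le> ereal (1 / K)"
    using K by (simp add: arctan_le_self)
  finally show ?thesis .
qed

section \<open>The area and the final choice of height\<close>

text \<open>The square \<open>[0, K] \<times> [0, K]\<close> contains all nodes and, being convex,
  all edges, so it is one of the boxes in the infimum.\<close>

lemma drawing_area_grid_layout_le:
  assumes K: "K > 0" "real m \<le> K" "real n \<le> K"
  shows "drawing_area (Kbip_verts m n) (Kbip_edges m n) (grid_layout K) \<le> K\<^sup>2"
proof -
  let ?B = "cbox (0, 0) (K, K) :: point set"
  have verts: "grid_layout K ` Kbip_verts m n \<subseteq> ?B"
    using K unfolding Kbip_verts_def Kbip_left_def Kbip_right_def by (auto simp: cbox_Pair_eq)
  have "e \<subseteq> Kbip_verts m n" if "e \<in> Kbip_edges m n" for e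
    using that unfolding Kbip_edges_def Kbip_verts_def by auto
  then have "convex hull (grid_layout K ` e) \<subseteq> ?B" if "e \<in> Kbip_edges m n" for e
    using that verts by (intro hull_minimal) (auto simp: convex_box)
  then have sub: "drawing_points (Kbip_verts m n) (Kbip_edges m n) (grid_layout K) \<subseteq> ?B"
    unfolding drawing_points_def using verts by blast
  have "drawing_area (Kbip_verts m n) (Kbip_edges m n) (grid_layout K) \<le> measure lborel ?B"
    unfolding drawing_area_def using sub by (intro cInf_lower) (auto intro!: bdd_belowI[of _ 0])
  also have "\<dots> = K\<^sup>2" using K by (simp add: content_Pair power2_eq_square)
  finally show ?thesis .
qed

theorem theorem3:
  "\<exists>c C D :: real. 0 < c \<and> c \<le> C \<and> 0 < D \<and>
     (\<forall>m n :: nat. 0 < m \<longrightarrow> 0 < n \<longrightarrow> 2 \<le> max m n \<longrightarrow>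
       (\<exists>p :: nat + nat \<Rightarrow> point.
          straight_line_drawing (Kbip_verts m n) p \<and>
          two_layered (Kbip_left m) (Kbip_right n) p \<and>
          grid_drawing (Kbip_verts m n) p \<and>
          ereal (c / real (max m n)) \<le> total_resolution (Kbip_verts m n) (Kbip_edges m n) p \<and>
          total_resolution (Kbip_verts m n) (Kbip_edges m n) p \<le> ereal (C / real (max m n)) \<and>
          drawing_area (Kbip_verts m n) (Kbip_edges m n) p \<le> D * max (real m ^ 2) (real n ^ 2)))"
proof (rule exI[of _ "1 / 2"], rule exI[of _ 1], rule exI[of _ 1], intro conjI allI impI)
  \<comment> \<open>The constants come from the bounds for height \<open>K\<close>:
    \<open>1 / (2 * K)\<close> gives \<open>c = 1 / 2\<close>,
    \<open>arctan (1 / K) \<le> 1 / K\<close> gives \<open>C = 1\<close>, and the enclosing square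
    of side \<open>K\<close> gives \<open>D = 1\<close>.\<close>
  fix m n :: nat
  assume mn: "0 < m" "0 < n" "2 \<le> max m n"
  define K where "K = real (max m n)"
  have K: "K > 0" "real m \<le> K" "real n \<le> K" using mn unfolding K_def by auto
  let ?p = "grid_layout K"
  have "straight_line_drawing (Kbip_verts m n) ?p"
    using K unfolding straight_line_drawing_def Kbip_verts_def Kbip_left_def Kbip_right_def
    by (auto simp: inj_on_def)
  moreover have "two_layered (Kbip_left m) (Kbip_right n) ?p"
    unfolding two_layered_def
  proof (intro exI conjI)
    have "(0, 0) \<in> {q :: point. snd q = 0}" "(0, 0) \<notin> {q :: point. snd q = K}" using K by auto
    then show "{q :: point. snd q = 0} \<noteq> {q. snd q = K}" by blast
  qed (auto simp: line_horizontal affine_parallel_horizontal Kbip_left_def Kbip_right_def)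
  moreover have "grid_drawing (Kbip_verts m n) ?p"
    unfolding grid_drawing_def Kbip_verts_def Kbip_left_def Kbip_right_def by (auto simp: K_def)
  moreover have "ereal (1 / 2 / real (max m n)) \<le> total_resolution (Kbip_verts m n) (Kbip_edges m n) ?p"
    using angular_resolution_grid_layout_ge[OF K] crossing_resolution_grid_layout_ge[OF K]
    unfolding total_resolution_def by (simp add: K_def)
  \<comment> \<open>The angular part has to give this bound, since for a star, where
    \<open>m = 1\<close> or \<open>n = 1\<close>, nothing crosses and the crossing resolution is
    infinite.\<close>
  moreover have "total_resolution (Kbip_verts m n) (Kbip_edges m n) ?p \<le> ereal (1 / real (max m n))"
    using angular_resolution_grid_layout_le[OF K(1) mn]
    unfolding total_resolution_def K_def by (rule min.coboundedI1)
  moreover have "drawing_area (Kbip_verts m n) (Kbip_edges m n) ?p \<le> 1 * max (real m ^ 2) (real n ^ 2)"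
  proof -
    have "K\<^sup>2 \<le> max (real m ^ 2) (real n ^ 2)" unfolding K_def by (simp add: max_def)
    then show ?thesis using drawing_area_grid_layout_le[OF K] by simp
  qed
  ultimately show "\<exists>p :: nat + nat \<Rightarrow> point.
          straight_line_drawing (Kbip_verts m n) p \<and>
          two_layered (Kbip_left m) (Kbip_right n) p \<and>
          grid_drawing (Kbip_verts m n) p \<and>
          ereal (1 / 2 / real (max m n)) \<le> total_resolution (Kbip_verts m n) (Kbip_edges m n) p \<and>
          total_resolution (Kbip_verts m n) (Kbip_edges m n) p \<le> ereal (1 / real (max m n)) \<and>
          drawing_area (Kbip_verts m n) (Kbip_edges m n) p \<le> 1 * max (real m ^ 2) (real n ^ 2)"
    by blast
qed auto

end
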